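(* Let $h(\alpha) = 1 - \alpha + \sum_{n \ge 2} t_n v^{n-1} e^{n} f\, \alpha^n$ and, for an integer $q \ge 2$, let $h_q(\alpha) = 1 - \alpha + \sum_{n=2}^{q} t_n v^{n-1} e^{n} f\, \alpha^n$. For an integer $d \ge 0$ define $$\beta_{d.} = \sum_{\mathbf{m}:\, V_{\mathbf{m}}-2 \le d} C_{\mathbf{m}} v^{V_{\mathbf{m}}-2}e^{E_{\mathbf{m}}-1}f^{F_{\mathbf{m}}}\mathbf{t}^{\mathbf{m}},\qquad \beta_{d\_} = \sum_{\mathbf{m}:\, E_{\mathbf{m}}-1 \le d} C_{\mathbf{m}} v^{V_{\mathbf{m}}-2}e^{E_{\mathbf{m}}-1}f^{F_{\mathbf{m}}}\mathbf{t}^{\mathbf{m}},$$ $$\beta_{d\Delta} = \sum_{\mathbf{m}:\, F_{\mathbf{m}} \le d} C_{\mathbf{m}} v^{V_{\mathbf{m}}-2}e^{E_{\mathbf{m}}-1}f^{F_{\mathbf{m}}}\mathbf{t}^{\mathbf{m}},\qquad \beta_{d\Delta q} = \sum_{\substack{\mathbf{m} = [m_2,\ldots,m_q]\\ F_{\mathbf{m}} \le d}} C_{\mathbf{m}} v^{V_{\mathbf{m}}-2}e^{E_{\mathbf{m}}-1}f^{F_{\mathbf{m}}}\mathbf{t}^{\mathbf{m}},$$ where in $\beta_{d\Delta q}$ only types with $m_k = 0$ for all $k > q$ are included. Then $$h(\beta_{d.}) \bmod v^{d+1} = 0,\quad h(\beta_{d\_}) \bmod e^{d+1} = 0,\quad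 h(\beta_{d\Delta}) \bmod f^{d+1} = 0,\quad h_q(\beta_{d\Delta q}) \bmod f^{d+1} = 0.$$
   Context: Everything lives in the ring of formal power series over $\mathbb{Q}$ in $t_2, t_3, \ldots, v, e, f$. A type is a vector $\mathbf{m} = [m_2, m_3, \ldots]$ of nonnegative integers with finitely many nonzero entries; $\mathbf{t}^{\mathbf{m}} = \prod_k t_k^{m_k}$, $\mathbf{m}! = \prod_k m_k!$, $V_{\mathbf{m}} = 2 + \sum_{k\ge 2}(k-1)m_k$, $E_{\mathbf{m}} = 1 + \sum_{k\ge 2} k m_k$, $F_{\mathbf{m}} = \sum_{k \ge 2} m_k$, and $C_{\mathbf{m}} = \dfrac{(E_{\mathbf{m}}-1)!}{(V_{\mathbf{m}}-1)!\,\mathbf{m}!}$. For a variable $z \in \{v,e,f\}$, "$X \bmod z^{d+1}$" denotes the series obtained from $X$ by deleting all terms in which the exponent of $z$ is at least $d+1$ (the remainder upon division by $z^{d+1}$). *)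

theory Defs
  imports Complex_Main "HOL-Library.Poly_Mapping"
begin

section \<open>Formal power series in arbitrarily many variables\<close>

text \<open>A monomial in variables from \<open>'x\<close> is a finitely supported exponent vector
  of type \<open>'x \<Rightarrow>\<^sub>0 nat\<close>; a power series is an arbitrary assignment of coefficients to monomials.\<close>

typedef ('x, 'a) mps = "UNIV :: (('x \<Rightarrow>\<^sub>0 nat) \<Rightarrow> 'a) set"
  morphisms mps_coeff Abs_mps ..

lemma mps_coeff_Abs [simp]: "mps_coeff (Abs_mps c) = c"
  by (simp add: Abs_mps_inverse)

lemma mps_eq_iff: "X = Y \<longleftrightarrow> (\<forall>a. mps_coeff X a = mps_coeff Y a)"
  by (metis ext mps_coeff_inject)

lemma mps_eqI: "(\<And>a. mps_coeff X a = mps_coeff Y a) \<Longrightarrow> X = Y"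
  by (simp add: mps_eq_iff)

definition mps_split :: "('x \<Rightarrow>\<^sub>0 nat) \<Rightarrow> (('x \<Rightarrow>\<^sub>0 nat) \<times> ('x \<Rightarrow>\<^sub>0 nat)) set" where
  "mps_split a = {(b, c). b + c = a}"

lemma finite_mps_split [simp]: "finite (mps_split a)"
proof -
  let ?B = "{b. \<exists>c. b + c = a}"
  let ?N = "\<Union>y\<in>Poly_Mapping.keys a. {..Poly_Mapping.lookup a y}"
  let ?S = "{g. \<forall>x. (x \<in> Poly_Mapping.keys a \<longrightarrow> g x \<in> ?N) \<and> (x \<notin> Poly_Mapping.keys a \<longrightarrow> g x = 0)}"
  have "finite ?S"
    by (rule finite_set_of_finite_funs) auto
  moreover have "Poly_Mapping.lookup ` ?B \<subseteq> ?S"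
  proof clarify
    fix b c x
    assume "a = b + c"
    then have le: "Poly_Mapping.lookup b x \<le> Poly_Mapping.lookup (b + c) x"
      by (simp add: lookup_add)
    show "(x \<in> Poly_Mapping.keys (b + c) \<longrightarrow> Poly_Mapping.lookup b x
        \<in> (\<Union>y\<in>Poly_Mapping.keys (b + c). {..Poly_Mapping.lookup (b + c) y}))
      \<and> (x \<notin> Poly_Mapping.keys (b + c) \<longrightarrow> Poly_Mapping.lookup b x = 0)"
      using le by (metis UN_I atMost_iff in_keys_iff le_zero_eq)
  qed
  ultimately have "finite (Poly_Mapping.lookup ` ?B)"
    by (rule rev_finite_subset)
  then have B: "finite ?B"
    by (rule finite_imageD) (simp add: inj_on_def poly_mapping.lookup_inject)
  have "mps_split a \<subseteq> ?B \<times> ?B"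
    by (auto simp: mps_split_def) (metis add.commute)
  then show ?thesis
    using B finite_subset by blast
qed

lemma mps_split_0 [simp]: "mps_split 0 = {(0, 0)}"
proof -
  have "b = 0 \<and> c = 0" if "b + c = 0" for b c :: "'x \<Rightarrow>\<^sub>0 nat"
  proof -
    have "Poly_Mapping.lookup b x + Poly_Mapping.lookup c x = 0" for x
      using that by (metis lookup_add lookup_zero)
    then show ?thesis
      by (auto intro!: poly_mapping_eqI)
  qed
  then show ?thesis
    by (auto simp: mps_split_def)
qed

instantiation mps :: (type, comm_ring_1) comm_ring_1
begin

definition "0 = Abs_mps (\<lambda>_. 0)"
definition "1 = Abs_mps (\<lambda>a. if a = 0 then 1 else 0)"
definition "X + Y = Abs_mps (\<lambda>a. mps_coeff X a + mps_coeff Y a)"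
definition "X - Y = Abs_mps (\<lambda>a. mps_coeff X a - mps_coeff Y a)"
definition "- X = Abs_mps (\<lambda>a. - mps_coeff X a)"
definition "X * Y = Abs_mps (\<lambda>a. \<Sum>(b, c)\<in>mps_split a. mps_coeff X b * mps_coeff Y c)"

instance
proof
  fix X Y Z :: "('a, 'b) mps"
  show "X + Y + Z = X + (Y + Z)" "X + Y = Y + X" "0 + X = X" "- X + X = 0" "X - Y = X + - Y"
    by (simp_all add: plus_mps_def zero_mps_def uminus_mps_def minus_mps_def ac_simps)
      (simp add: mps_coeff_inverse)
  show "(0::('a, 'b) mps) \<noteq> 1"
    by (auto simp: mps_eq_iff zero_mps_def one_mps_def)
  show "(X + Y) * Z = X * Z + Y * Z"
    by (simp add: times_mps_def plus_mps_def algebra_simps sum.distrib case_prod_beta)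
  show "X * Y = Y * X"
  proof (rule mps_eqI)
    fix a
    have "(\<Sum>(b, c)\<in>mps_split a. mps_coeff X b * mps_coeff Y c)
        = (\<Sum>(b, c)\<in>mps_split a. mps_coeff Y b * mps_coeff X c)"
      by (rule sum.reindex_bij_witness[where i = prod.swap and j = prod.swap])
        (auto simp: mps_split_def ac_simps)
    then show "mps_coeff (X * Y) a = mps_coeff (Y * X) a"
      by (simp add: times_mps_def)
  qed
  show "1 * X = X"
  proof (rule mps_eqI)
    fix a
    have "mps_coeff (1 * X) a = (\<Sum>(b, c)\<in>mps_split a. if b = 0 then mps_coeff X c else 0)"
      by (auto simp: times_mps_def one_mps_def intro!: sum.cong)
    also have "\<dots> = (\<Sum>(b, c)\<in>{(0 :: 'a \<Rightarrow>\<^sub>0 nat, a)}. if b = 0 then mps_coeff X c else 0)"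
      by (rule sum.mono_neutral_right) (simp, auto simp: mps_split_def split: if_splits)
    finally show "mps_coeff (1 * X) a = mps_coeff X a"
      by simp
  qed
  show "X * Y * Z = X * (Y * Z)"
  proof (rule mps_eqI)
    fix a
    let ?g = "\<lambda>b c d. mps_coeff X b * mps_coeff Y c * mps_coeff Z d"
    have "mps_coeff (X * Y * Z) a = (\<Sum>p\<in>mps_split a. \<Sum>q\<in>mps_split (fst p). ?g (fst q) (snd q) (snd p))"
      by (simp add: times_mps_def case_prod_beta sum_distrib_right)
    also have "\<dots> = (\<Sum>(p, q)\<in>(SIGMA p:mps_split a. mps_split (fst p)). ?g (fst q) (snd q) (snd p))"
      by (rule sum.Sigma) auto
    also have "\<dots> = (\<Sum>(p, q)\<in>(SIGMA p:mps_split a. mps_split (snd p)). ?g (fst p) (fst q) (snd q))"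
      by (rule sum.reindex_bij_witness[where
            i = "\<lambda>(p, q). ((fst p + fst q, snd q), (fst p, fst q))" and
            j = "\<lambda>(p, q). ((fst q, snd q + snd p), (snd q, snd p))"])
        (auto simp: mps_split_def ac_simps)
    also have "\<dots> = (\<Sum>p\<in>mps_split a. \<Sum>q\<in>mps_split (snd p). ?g (fst p) (fst q) (snd q))"
      by (rule sum.Sigma[symmetric]) auto
    also have "\<dots> = mps_coeff (X * (Y * Z)) a"
      by (simp add: times_mps_def case_prod_beta sum_distrib_left mult.assoc)
    finally show "mps_coeff (X * Y * Z) a = mps_coeff (X * (Y * Z)) a" .
  qed
qed

end

lemma mps_coeff_simps [simp]:
  fixes X Y :: "('x, 'a::comm_ring_1) mps"
  shows "mps_coeff (0 :: ('x, 'a) mps) a = 0"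
    and "mps_coeff (1 :: ('x, 'a) mps) a = (if a = 0 then 1 else 0)"
    and "mps_coeff (X + Y) a = mps_coeff X a + mps_coeff Y a"
    and "mps_coeff (X - Y) a = mps_coeff X a - mps_coeff Y a"
    and "mps_coeff (- X) a = - mps_coeff X a"
  by (simp_all add: zero_mps_def one_mps_def plus_mps_def minus_mps_def uminus_mps_def)

lemma mps_coeff_mult:
  "mps_coeff (X * Y) a = (\<Sum>(b, c)\<in>mps_split a. mps_coeff X b * mps_coeff Y c)"
  by (simp add: times_mps_def)

definition mps_monom :: "('x \<Rightarrow>\<^sub>0 nat) \<Rightarrow> 'a \<Rightarrow> ('x, 'a::comm_ring_1) mps" where
  "mps_monom a c = Abs_mps (\<lambda>b. if b = a then c else 0)"

definition mps_const :: "'a \<Rightarrow> ('x, 'a::comm_ring_1) mps" where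
  "mps_const c = mps_monom 0 c"

definition mps_var :: "'x \<Rightarrow> ('x, 'a::comm_ring_1) mps" where
  "mps_var x = mps_monom (Poly_Mapping.single x 1) 1"

text \<open>\<open>mps_mod X z k\<close> is the remainder of \<open>X\<close> upon division by the \<open>k\<close>-th power of the variable \<open>z\<close>.\<close>

definition mps_mod :: "('x, 'a::comm_ring_1) mps \<Rightarrow> 'x \<Rightarrow> nat \<Rightarrow> ('x, 'a) mps" where
  "mps_mod X z k = Abs_mps (\<lambda>a. if Poly_Mapping.lookup a z \<ge> k then 0 else mps_coeff X a)"

text \<open>Formal infinite sums are taken coefficientwise.  They are meaningful for locally finite
  families, in which every monomial occurs in only finitely many members; all families summed below
  are locally finite, see \<open>locally_finite_h\<close> and \<open>locally_finite_hcat_term\<close>.\<close>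

definition mps_locally_finite :: "('i \<Rightarrow> ('x, 'a::comm_ring_1) mps) \<Rightarrow> 'i set \<Rightarrow> bool" where
  "mps_locally_finite X I \<longleftrightarrow> (\<forall>a. finite {i \<in> I. mps_coeff (X i) a \<noteq> 0})"

definition mps_infsum :: "('i \<Rightarrow> ('x, 'a::comm_ring_1) mps) \<Rightarrow> 'i set \<Rightarrow> ('x, 'a) mps" where
  "mps_infsum X I = Abs_mps (\<lambda>a. \<Sum>i | i \<in> I \<and> mps_coeff (X i) a \<noteq> 0. mps_coeff (X i) a)"

lemma mps_coeff_sum: "mps_coeff (sum X I) a = (\<Sum>i\<in>I. mps_coeff (X i) a)"
  by (induction I rule: infinite_finite_induct) auto

lemma mps_infsum_finite: "finite I \<Longrightarrow> mps_infsum X I = sum X I"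
  by (rule mps_eqI) (auto simp: mps_infsum_def mps_coeff_sum intro!: sum.mono_neutral_left)

lemma mps_coeff_monom [simp]: "mps_coeff (mps_monom a c) b = (if b = a then c else 0)"
  by (simp add: mps_monom_def)

lemma mps_monom_mult: "mps_monom a c * mps_monom b d = mps_monom (a + b) (c * d)"
proof (rule mps_eqI)
  fix u
  have "mps_coeff (mps_monom a c * mps_monom b d) u
      = (\<Sum>p\<in>mps_split u. if p = (a, b) then c * d else 0)"
    unfolding mps_coeff_mult by (rule sum.cong) (auto split: if_splits)
  also have "\<dots> = (if (a, b) \<in> mps_split u then c * d else 0)"
    by simp
  finally show "mps_coeff (mps_monom a c * mps_monom b d) u = mps_coeff (mps_monom (a + b) (c * d)) u"
    by (auto simp: mps_split_def)
qed

lemma mps_monom_prod: "(\<Prod>i\<in>I. mps_monom (a i) (c i)) = mps_monom (\<Sum>i\<in>I. a i) (\<Prod>i\<in>I. c i)"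
  by (induction I rule: infinite_finite_induct)
    (auto simp: mps_monom_mult intro!: mps_eqI)

lemma mps_var_power: "mps_var x ^ n = mps_monom (Poly_Mapping.single x n) 1"
proof (induction n)
  case 0
  show ?case by (auto intro!: mps_eqI)
next
  case (Suc n)
  then show ?case
    by (simp add: mps_var_def mps_monom_mult single_add[symmetric])
qed

lemma mps_coeff_var_mult_nonzero:
  assumes "mps_coeff (mps_var x * X) a \<noteq> 0"
  shows "x \<in> Poly_Mapping.keys a"
proof (rule ccontr)
  assume "x \<notin> Poly_Mapping.keys a"
  then have "b \<noteq> Poly_Mapping.single x 1" if "(b, c) \<in> mps_split a" for b c
    using that by (auto simp: mps_split_def in_keys_iff lookup_add)
  then have "mps_coeff (mps_var x * X) a = 0"
    unfolding mps_coeff_mult by (intro sum.neutral) (auto simp: mps_var_def)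
  with assms show False by simp
qed


section \<open>Types and hyper-Catalan coefficients\<close>

text \<open>The spare variables \<open>T 0\<close> and \<open>T 1\<close> never occur below.\<close>

datatype gvar = T nat | V | E | F

type_synonym series = "(gvar, rat) mps"

text \<open>A type \<open>[m\<^sub>2, m\<^sub>3, \<dots>]\<close> is the finitely supported function \<open>k \<mapsto> m\<^sub>k\<close>.\<close>

definition types :: "(nat \<Rightarrow>\<^sub>0 nat) set" where
  "types = {m. Poly_Mapping.keys m \<subseteq> {2..}}"

definition V_of :: "(nat \<Rightarrow>\<^sub>0 nat) \<Rightarrow> nat" where
  "V_of m = 2 + (\<Sum>k\<in>Poly_Mapping.keys m. (k - 1) * Poly_Mapping.lookup m k)"

definition E_of :: "(nat \<Rightarrow>\<^sub>0 nat) \<Rightarrow> nat" where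
  "E_of m = 1 + (\<Sum>k\<in>Poly_Mapping.keys m. k * Poly_Mapping.lookup m k)"

definition F_of :: "(nat \<Rightarrow>\<^sub>0 nat) \<Rightarrow> nat" where
  "F_of m = (\<Sum>k\<in>Poly_Mapping.keys m. Poly_Mapping.lookup m k)"

definition C_of :: "(nat \<Rightarrow>\<^sub>0 nat) \<Rightarrow> rat" where
  "C_of m = fact (E_of m - 1) / (fact (V_of m - 1) * (\<Prod>k\<in>Poly_Mapping.keys m. fact (Poly_Mapping.lookup m k)))"

definition t_pow :: "(nat \<Rightarrow>\<^sub>0 nat) \<Rightarrow> series" where
  "t_pow m = (\<Prod>k\<in>Poly_Mapping.keys m. mps_var (T k) ^ Poly_Mapping.lookup m k)"

definition hcat_term :: "(nat \<Rightarrow>\<^sub>0 nat) \<Rightarrow> series" where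
  "hcat_term m = mps_const (C_of m) * mps_var V ^ (V_of m - 2) * mps_var E ^ (E_of m - 1)
     * mps_var F ^ F_of m * t_pow m"

definition h :: "series \<Rightarrow> series" where
  "h \<alpha> = 1 - \<alpha> + mps_infsum
     (\<lambda>n. mps_var (T n) * mps_var V ^ (n - 1) * mps_var E ^ n * mps_var F * \<alpha> ^ n) {2..}"

definition h_upto :: "nat \<Rightarrow> series \<Rightarrow> series" where
  "h_upto q \<alpha> = 1 - \<alpha> +
     (\<Sum>n=2..q. mps_var (T n) * mps_var V ^ (n - 1) * mps_var E ^ n * mps_var F * \<alpha> ^ n)"

definition beta_V :: "nat \<Rightarrow> series" where
  "beta_V d = mps_infsum hcat_term {m \<in> types. V_of m - 2 \<le> d}"

definition beta_E :: "nat \<Rightarrow> series" where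
  "beta_E d = mps_infsum hcat_term {m \<in> types. E_of m - 1 \<le> d}"

definition beta_F :: "nat \<Rightarrow> series" where
  "beta_F d = mps_infsum hcat_term {m \<in> types. F_of m \<le> d}"

definition beta_F_upto :: "nat \<Rightarrow> nat \<Rightarrow> series" where
  "beta_F_upto d q = mps_infsum hcat_term {m \<in> types. (\<forall>k>q. Poly_Mapping.lookup m k = 0) \<and> F_of m \<le> d}"

lemma locally_finite_h:
  "mps_locally_finite
     (\<lambda>n. mps_var (T n) * mps_var V ^ (n - 1) * mps_var E ^ n * mps_var F * \<alpha> ^ n :: series) {2..}"
  unfolding mps_locally_finite_def
proof
  fix a :: "gvar \<Rightarrow>\<^sub>0 nat"
  have "finite (T -` Poly_Mapping.keys a)"
    by (rule finite_vimageI) (auto simp: inj_on_def)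
  then show "finite {n \<in> {2..}.
      mps_coeff (mps_var (T n) * mps_var V ^ (n - 1) * mps_var E ^ n * mps_var F * \<alpha> ^ n :: series) a \<noteq> 0}"
    by (rule rev_finite_subset) (auto simp: mult.assoc dest: mps_coeff_var_mult_nonzero)
qed

lemma hcat_term_eq_monom:
  "hcat_term m = mps_monom (Poly_Mapping.single V (V_of m - 2) + Poly_Mapping.single E (E_of m - 1)
     + Poly_Mapping.single F (F_of m) + (\<Sum>k\<in>Poly_Mapping.keys m. Poly_Mapping.single (T k) (Poly_Mapping.lookup m k))) (C_of m)"
  by (simp add: hcat_term_def t_pow_def mps_const_def mps_var_power mps_monom_mult mps_monom_prod)

lemma mps_coeff_hcat_term_nonzero:
  assumes "mps_coeff (hcat_term m) a \<noteq> 0"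
  shows "Poly_Mapping.lookup m k = Poly_Mapping.lookup a (T k)"
proof -
  have "Poly_Mapping.lookup a (T k) = (\<Sum>i\<in>Poly_Mapping.keys m. Poly_Mapping.lookup (Poly_Mapping.single (T i) (Poly_Mapping.lookup m i)) (T k))"
    using assms by (auto simp: hcat_term_eq_monom lookup_add lookup_sum lookup_single split: if_splits)
  also have "\<dots> = (\<Sum>i\<in>Poly_Mapping.keys m. if i = k then Poly_Mapping.lookup m k else 0)"
    by (rule sum.cong) (auto simp: lookup_single)
  finally show ?thesis
    by (simp add: in_keys_iff)
qed

lemma locally_finite_hcat_term: "mps_locally_finite hcat_term A"
  unfolding mps_locally_finite_def
proof
  fix a
  have "inj_on (\<lambda>_. ()) {m \<in> A. mps_coeff (hcat_term m) a \<noteq> 0}"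
    by (rule inj_onI) (auto intro!: poly_mapping_eqI simp: mps_coeff_hcat_term_nonzero)
  then show "finite {m \<in> A. mps_coeff (hcat_term m) a \<noteq> 0}"
    by (rule inj_on_finite[where B = UNIV]) auto
qed

end

theory Submission
  imports Defs
begin

text \<open>
  Let \<open>x\<^sub>n = t\<^sub>n v\<^bsup>n-1\<^esup> e\<^sup>n f\<close>. The series \<open>G\<^sub>r\<close> whose coefficients are
  \<open>r (r + a - 1)! / ((r + a - b)! m!)\<close>, with \<open>a = \<Sum> k m\<^sub>k\<close> and \<open>b = \<Sum> m\<^sub>k\<close>, satisfy
  \<open>G\<^sub>0 = 1\<close> and \<open>G\<^bsub>r+1\<^esub> = G\<^sub>r + \<Sum>\<^sub>n x\<^sub>n G\<^bsub>r+n\<^esub>\<close>. This linear recurrence determines the family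
  from its initial member, because every \<open>x\<^sub>n\<close> is divisible by \<open>f\<close>. Both \<open>G\<^sub>1 G\<^sub>r\<close> and
  \<open>G\<^bsub>r+1\<^esub>\<close> satisfy it and agree at \<open>r = 0\<close>; hence \<open>G\<^sub>r = G\<^sub>1\<^sup>r\<close>, and the recurrence
  at \<open>r = 0\<close> says that the full hyper-Catalan series \<open>G\<^sub>1\<close> is a zero of \<open>h\<close>. Truncating
  \<open>G\<^sub>1\<close> in one variable changes \<open>h\<close> only in the discarded degrees.
\<close>

section \<open>Coefficientwise sums and products of power series\<close>

lemma mps_coeff_infsum_superset:
  assumes "finite A" "A \<subseteq> I" "\<And>i. i \<in> I - A \<Longrightarrow> mps_coeff (X i) a = 0"
  shows "mps_coeff (mps_infsum X I) a = (\<Sum>i\<in>A. mps_coeff (X i) a)"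
  unfolding mps_infsum_def mps_coeff_Abs
  using assms by (intro sum.mono_neutral_left) auto

lemma mps_coeff_infsum_cong:
  assumes "\<And>i. i \<in> I \<Longrightarrow> mps_coeff (X i) a = mps_coeff (Y i) b"
  shows "mps_coeff (mps_infsum X I) a = mps_coeff (mps_infsum Y I) b"
  unfolding mps_infsum_def mps_coeff_Abs
  using assms by (intro sum.cong) auto

text \<open>A monomial has finitely many splittings, and local finiteness leaves finitely many
  indices at each right part, so both sides reduce to sums over one finite set.\<close>

lemma mps_infsum_mult_left:
  assumes "mps_locally_finite X I"
  shows "Y * mps_infsum X I = mps_infsum (\<lambda>i. Y * X i) I"
proof (rule mps_eqI)
  fix a
  define A where "A = (\<Union>p\<in>mps_split a. {i \<in> I. mps_coeff (X i) (snd p) \<noteq> 0})"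
  have A: "finite A" "A \<subseteq> I"
    using assms by (auto simp: A_def mps_locally_finite_def)
  have inner: "mps_coeff (mps_infsum X I) c = (\<Sum>i\<in>A. mps_coeff (X i) c)" if "(b, c) \<in> mps_split a" for b c
    using A that by (intro mps_coeff_infsum_superset) (force simp: A_def)+
  have "mps_coeff (Y * mps_infsum X I) a
      = (\<Sum>p\<in>mps_split a. \<Sum>i\<in>A. mps_coeff Y (fst p) * mps_coeff (X i) (snd p))"
    unfolding mps_coeff_mult
    by (rule sum.cong) (auto simp: inner sum_distrib_left)
  also have "\<dots> = (\<Sum>i\<in>A. mps_coeff (Y * X i) a)"
    by (subst sum.swap) (simp add: mps_coeff_mult case_prod_beta)
  also have "\<dots> = mps_coeff (mps_infsum (\<lambda>i. Y * X i) I) a"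
    using A by (intro mps_coeff_infsum_superset[symmetric])
      (force simp: A_def mps_coeff_mult intro!: sum.neutral)+
  finally show "mps_coeff (Y * mps_infsum X I) a = mps_coeff (mps_infsum (\<lambda>i. Y * X i) I) a" .
qed

lemma mps_coeff_monom_mult: "mps_coeff (mps_monom b c * X) (b + a) = c * mps_coeff X a"
proof -
  have "mps_coeff (mps_monom b c * X) (b + a)
      = (\<Sum>p\<in>mps_split (b + a). if p = (b, a) then c * mps_coeff X a else 0)"
    unfolding mps_coeff_mult by (rule sum.cong) (auto simp: mps_split_def split: if_splits)
  also have "\<dots> = c * mps_coeff X a"
    using finite_mps_split[of "b + a"] by (subst sum.delta) (auto simp: mps_split_def)
  finally show ?thesis .
qed

lemma mps_coeff_monom_mult_nonzero:
  assumes "mps_coeff (mps_monom b c * X) a \<noteq> 0"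
  obtains a' where "a = b + a'" "mps_coeff X a' \<noteq> 0"
proof -
  obtain p where "p \<in> mps_split a" "mps_coeff (mps_monom b c) (fst p) * mps_coeff X (snd p) \<noteq> 0"
    using assms by (auto simp: mps_coeff_mult case_prod_beta elim!: sum.not_neutral_contains_not_neutral)
  then show thesis
    using that[of "snd p"] by (cases "mps_coeff X (snd p) = 0") (auto simp: mps_split_def split: if_splits)
qed

section \<open>Congruence modulo a power of a variable\<close>

definition mps_cong :: "'x \<Rightarrow> nat \<Rightarrow> ('x, 'a::comm_ring_1) mps \<Rightarrow> ('x, 'a) mps \<Rightarrow> bool" where
  "mps_cong z k X Y \<longleftrightarrow> (\<forall>a. Poly_Mapping.lookup a z < k \<longrightarrow> mps_coeff X a = mps_coeff Y a)"

lemma mps_cong_refl [simp]: "mps_cong z k X X"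
  by (simp add: mps_cong_def)

lemma mps_cong_add: "mps_cong z k X X' \<Longrightarrow> mps_cong z k Y Y' \<Longrightarrow> mps_cong z k (X + Y) (X' + Y')"
  by (simp add: mps_cong_def)

lemma mps_cong_diff: "mps_cong z k X X' \<Longrightarrow> mps_cong z k Y Y' \<Longrightarrow> mps_cong z k (X - Y) (X' - Y')"
  by (simp add: mps_cong_def)

text \<open>The degree in \<open>z\<close> is additive, so both parts of a splitting of a monomial
  of degree below \<open>k\<close> stay below \<open>k\<close>.\<close>

lemma mps_cong_mult:
  assumes "mps_cong z k X X'" "mps_cong z k Y Y'"
  shows "mps_cong z k (X * Y) (X' * Y')"
  using assms unfolding mps_cong_def mps_coeff_mult
  by (auto simp: mps_split_def lookup_add intro!: sum.cong)

lemma mps_cong_power: "mps_cong z k X Y \<Longrightarrow> mps_cong z k (X ^ n) (Y ^ n)"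
  by (induction n) (auto intro: mps_cong_mult)

lemma mps_cong_infsum:
  assumes "\<And>i. i \<in> I \<Longrightarrow> mps_cong z k (X i) (Y i)"
  shows "mps_cong z k (mps_infsum X I) (mps_infsum Y I)"
  using assms unfolding mps_cong_def by (auto intro: mps_coeff_infsum_cong)

lemma mps_mod_eq_0_if_cong: "mps_cong z k X 0 \<Longrightarrow> mps_mod X z k = 0"
  by (auto simp: mps_cong_def mps_mod_def intro!: mps_eqI)

section \<open>Weighted degrees of types\<close>

lemma sum_keys_superset:
  fixes m :: "'k \<Rightarrow>\<^sub>0 nat" and g :: "'k \<Rightarrow> nat \<Rightarrow> 'b::comm_monoid_add"
  assumes "finite A" "Poly_Mapping.keys m \<subseteq> A" "\<And>k. g k 0 = 0"
  shows "(\<Sum>k\<in>Poly_Mapping.keys m. g k (Poly_Mapping.lookup m k))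
    = (\<Sum>k\<in>A. g k (Poly_Mapping.lookup m k))"
  using assms by (intro sum.mono_neutral_left) (auto simp: in_keys_iff)

lemma sum_keys_add:
  fixes m n :: "'k \<Rightarrow>\<^sub>0 nat" and g :: "'k \<Rightarrow> nat \<Rightarrow> 'b::comm_monoid_add"
  assumes "\<And>k. g k 0 = 0" "\<And>k i j. g k (i + j) = g k i + g k j"
  shows "(\<Sum>k\<in>Poly_Mapping.keys (m + n). g k (Poly_Mapping.lookup (m + n) k))
    = (\<Sum>k\<in>Poly_Mapping.keys m. g k (Poly_Mapping.lookup m k))
      + (\<Sum>k\<in>Poly_Mapping.keys n. g k (Poly_Mapping.lookup n k))"
proof -
  let ?A = "Poly_Mapping.keys m \<union> Poly_Mapping.keys n"
  have eq: "(\<Sum>k\<in>Poly_Mapping.keys p. g k (Poly_Mapping.lookup p k)) = (\<Sum>k\<in>?A. g k (Poly_Mapping.lookup p k))"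
    if "Poly_Mapping.keys p \<subseteq> ?A" for p
    using that assms(1) by (intro sum_keys_superset) auto
  show ?thesis
    unfolding eq[OF Poly_Mapping.keys_add] eq[OF Un_upper1] eq[OF Un_upper2]
    by (simp add: assms(2) lookup_add sum.distrib)
qed

text \<open>Apart from the offset 2, \<open>V_of\<close> is linear in the type; the subtraction
  drops the second copy of the offset.\<close>

lemma V_of_add: "V_of (m + n) = V_of m + (V_of n - 2)"
  unfolding V_of_def by (subst sum_keys_add[where g = "\<lambda>k i. (k - 1) * i"]) (auto simp: distrib_left)

lemma E_of_add: "E_of (m + n) = E_of m + (E_of n - 1)"
  unfolding E_of_def by (subst sum_keys_add[where g = "\<lambda>k i. k * i"]) (auto simp: algebra_simps)

lemma F_of_add: "F_of (m + n) = F_of m + F_of n"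
  unfolding F_of_def by (subst sum_keys_add[where g = "\<lambda>k i. i"]) auto

lemma VEF_of_single [simp]:
  "V_of (Poly_Mapping.single n (Suc 0)) = 2 + (n - 1)"
  "E_of (Poly_Mapping.single n (Suc 0)) = 1 + n"
  "F_of (Poly_Mapping.single n (Suc 0)) = 1"
  by (simp_all add: V_of_def E_of_def F_of_def)

lemma VEF_of_zero [simp]: "V_of 0 = 2" "E_of 0 = 1" "F_of 0 = 0"
  by (simp_all add: V_of_def E_of_def F_of_def)

lemma V_of_ge: "V_of m \<ge> 2" and E_of_ge: "E_of m \<ge> 1"
  by (simp_all add: V_of_def E_of_def)

text \<open>Euler's relation, from \<open>(k - 1) + 1 = k\<close> in each summand; membership in
  \<open>types\<close> excludes \<open>k = 0\<close>, where natural subtraction would break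
  this.\<close>

lemma euler_VEF:
  assumes "m \<in> types"
  shows "V_of m + F_of m = E_of m + 1"
proof -
  have "(\<Sum>k\<in>Poly_Mapping.keys m. (k - 1) * Poly_Mapping.lookup m k) + F_of m
      = (\<Sum>k\<in>Poly_Mapping.keys m. k * Poly_Mapping.lookup m k)"
    unfolding F_of_def sum.distrib[symmetric]
    using assms by (intro sum.cong) (auto simp: types_def mult_eq_if)
  then show ?thesis
    by (simp add: V_of_def E_of_def)
qed

section \<open>Factorials and exponent vectors of types\<close>

definition type_fact :: "(nat \<Rightarrow>\<^sub>0 nat) \<Rightarrow> rat" where
  "type_fact m = (\<Prod>k\<in>Poly_Mapping.keys m. fact (Poly_Mapping.lookup m k))"

lemma type_fact_nonzero [simp]: "type_fact m \<noteq> 0"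
  by (simp add: type_fact_def)

lemma type_fact_add_single:
  "type_fact (Poly_Mapping.single n 1 + m) = of_nat (Poly_Mapping.lookup m n + 1) * type_fact m"
proof -
  let ?A = "insert n (Poly_Mapping.keys m)"
  have eq: "type_fact p = (\<Prod>k\<in>?A. fact (Poly_Mapping.lookup p k))" if "Poly_Mapping.keys p \<subseteq> ?A" for p
    unfolding type_fact_def
    using that by (intro prod.mono_neutral_left) (auto simp: in_keys_iff)
  have sub: "Poly_Mapping.keys (Poly_Mapping.single n 1 + m) \<subseteq> ?A"
    by (auto simp: in_keys_iff lookup_add lookup_single when_def split: if_splits)
  have "(\<Prod>k\<in>?A - {n}. fact (Poly_Mapping.lookup (Poly_Mapping.single n 1 + m) k) :: rat)
      = (\<Prod>k\<in>?A - {n}. fact (Poly_Mapping.lookup m k))"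
    by (intro prod.cong) (auto simp: lookup_add lookup_single when_def)
  then show ?thesis
    unfolding eq[OF sub] eq[OF subset_insertI]
    by (subst (1 2) prod.remove[where x = n]) (auto simp: lookup_add algebra_simps)
qed

text \<open>The exponent vector of \<open>hcat_term m\<close>. It is additive and injective in
  \<open>m\<close>, so coefficients can be indexed by types and products read as sums of
  types.\<close>

definition type_monom :: "(nat \<Rightarrow>\<^sub>0 nat) \<Rightarrow> gvar \<Rightarrow>\<^sub>0 nat" where
  "type_monom m = Poly_Mapping.single V (V_of m - 2) + Poly_Mapping.single E (E_of m - 1)
     + Poly_Mapping.single F (F_of m)
     + (\<Sum>k\<in>Poly_Mapping.keys m. Poly_Mapping.single (T k) (Poly_Mapping.lookup m k))"

lemma type_monom_zero [simp]: "type_monom 0 = 0"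
  by (simp add: type_monom_def)

lemma type_monom_add: "type_monom (m + n) = type_monom m + type_monom n"
proof -
  have "V_of (m + n) - 2 = (V_of m - 2) + (V_of n - 2)" "E_of (m + n) - 1 = (E_of m - 1) + (E_of n - 1)"
    using V_of_ge[of m] E_of_ge[of m] by (simp_all add: V_of_add E_of_add)
  then show ?thesis
    unfolding type_monom_def
    by (subst sum_keys_add[where g = "\<lambda>k i. Poly_Mapping.single (T k) i"])
      (simp_all only: F_of_add single_add single_zero ac_simps)
qed

lemma lookup_type_monom [simp]:
  "Poly_Mapping.lookup (type_monom m) V = V_of m - 2"
  "Poly_Mapping.lookup (type_monom m) E = E_of m - 1"
  "Poly_Mapping.lookup (type_monom m) F = F_of m"
  "Poly_Mapping.lookup (type_monom m) (T k) = Poly_Mapping.lookup m k"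
proof -
  have "(\<Sum>i\<in>Poly_Mapping.keys m. Poly_Mapping.lookup (Poly_Mapping.single (T i) (Poly_Mapping.lookup m i)) (T k))
    = (\<Sum>i\<in>Poly_Mapping.keys m. if i = k then Poly_Mapping.lookup m k else 0)"
    by (rule sum.cong) (auto simp: lookup_single)
  then show "Poly_Mapping.lookup (type_monom m) (T k) = Poly_Mapping.lookup m k"
    by (simp add: type_monom_def lookup_add lookup_sum lookup_single in_keys_iff)
qed (simp_all add: type_monom_def lookup_add lookup_sum lookup_single)

lemma type_monom_inject [simp]: "type_monom m = type_monom n \<longleftrightarrow> m = n"
  by (metis lookup_type_monom(4) poly_mapping_eqI)

lemma hcat_term_eq_type_monom: "hcat_term m = mps_monom (type_monom m) (C_of m)"
  by (simp add: hcat_term_eq_monom type_monom_def)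

section \<open>Powers of the hyper-Catalan series\<close>

definition face_var :: "nat \<Rightarrow> series" where
  "face_var n = mps_var (T n) * mps_var V ^ (n - 1) * mps_var E ^ n * mps_var F"

lemma face_var_eq_monom: "face_var n = mps_monom (type_monom (Poly_Mapping.single n 1)) 1"
  unfolding face_var_def mps_var_power
  by (simp add: mps_var_def mps_monom_mult type_monom_def ac_simps)

lemma locally_finite_face_var_mult: "mps_locally_finite (\<lambda>n. face_var n * Y n) K"
  unfolding mps_locally_finite_def
proof
  fix a :: "gvar \<Rightarrow>\<^sub>0 nat"
  have "finite (T -` Poly_Mapping.keys a)"
    by (rule finite_vimageI) (auto simp: inj_on_def)
  then show "finite {n \<in> K. mps_coeff (face_var n * Y n) a \<noteq> 0}"
    by (rule rev_finite_subset) (auto simp: face_var_def mult.assoc dest: mps_coeff_var_mult_nonzero)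
qed

lemma hcat_recurrence_unique:
  assumes "P 0 = Q 0"
    and P: "\<And>r. P (Suc r) = P r + mps_infsum (\<lambda>n. face_var n * P (r + n)) K"
    and Q: "\<And>r. Q (Suc r) = Q r + mps_infsum (\<lambda>n. face_var n * Q (r + n)) K"
  shows "P r = Q r"
proof (rule mps_eqI)
  fix a
  show "mps_coeff (P r) a = mps_coeff (Q r) a"
  proof (induction "Poly_Mapping.lookup a F" arbitrary: a r rule: less_induct)
    case less
    \<comment> \<open>\<open>face_var n\<close> uses up one power of \<open>F\<close>, so only
      coefficients of lower degree in \<open>F\<close> enter. The outer hypothesis covers them for
      every index \<open>s\<close>, however large; the step in \<open>r\<close> is then a plain
      induction.\<close>
    have eq: "mps_coeff (face_var n * P s) a = mps_coeff (face_var n * Q s) a" for n s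
      unfolding mps_coeff_mult
    proof (intro sum.cong refl, clarify)
      fix b c assume "(b, c) \<in> mps_split a"
      then have "Poly_Mapping.lookup a F = Poly_Mapping.lookup b F + Poly_Mapping.lookup c F"
        by (auto simp: mps_split_def lookup_add)
      then show "mps_coeff (face_var n) b * mps_coeff (P s) c = mps_coeff (face_var n) b * mps_coeff (Q s) c"
        by (auto simp: face_var_eq_monom less)
    qed
    show ?case
      by (induction r) (simp_all add: assms(1) P Q mps_coeff_infsum_cong[OF eq])
  qed
qed

section \<open>Coefficients of the powers\<close>

text \<open>The value that Lagrange inversion predicts for the \<open>r\<close>-th power. The zero
  type is set apart because at \<open>r = 0\<close> the formula would give 0 instead of the constant
  term 1.\<close>

definition hcat_pow_coeff :: "nat \<Rightarrow> (nat \<Rightarrow>\<^sub>0 nat) \<Rightarrow> rat" where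
  "hcat_pow_coeff r m = (if m = 0 then 1
     else of_nat r * fact (r + E_of m - 2) / (fact (r + V_of m - 2) * type_fact m))"

lemma hcat_pow_coeff_Suc:
  "hcat_pow_coeff (Suc r) m
    = of_nat (Suc r) * fact (r + E_of m - 1) / (fact (r + V_of m - 1) * type_fact m)"
proof (cases "m = 0")
  case True
  then show ?thesis
    by (simp add: hcat_pow_coeff_def type_fact_def)
next
  case False
  then show ?thesis
    using V_of_ge[of m] E_of_ge[of m] by (simp add: hcat_pow_coeff_def)
qed

lemma hcat_pow_coeff_1: "hcat_pow_coeff 1 m = C_of m"
  using hcat_pow_coeff_Suc[of 0 m] by (simp add: C_of_def type_fact_def)

lemma keys_minus_single_subset:
  fixes m :: "nat \<Rightarrow>\<^sub>0 nat"
  shows "Poly_Mapping.keys (m - Poly_Mapping.single k i) \<subseteq> Poly_Mapping.keys m"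
  by (auto simp: in_keys_iff lookup_minus)

lemma single_plus_minus_single:
  fixes m :: "nat \<Rightarrow>\<^sub>0 nat"
  assumes "k \<in> Poly_Mapping.keys m"
  shows "Poly_Mapping.single k 1 + (m - Poly_Mapping.single k 1) = m"
  using assms
  by (intro poly_mapping_eqI) (auto simp: lookup_add lookup_minus lookup_single when_def in_keys_iff)

text \<open>Lowering the entry at \<open>k\<close> by one lowers \<open>E_of\<close> by
  \<open>k\<close> and \<open>V_of\<close> by \<open>k - 1\<close>; raising the power by
  \<open>k\<close> compensates. All \<open>k\<close> thus share the same factorials, and the sum
  over \<open>k\<close> becomes linear.\<close>

lemma hcat_pow_coeff_minus_single:
  assumes m: "m \<in> types" and k: "k \<in> Poly_Mapping.keys m"
  shows "hcat_pow_coeff (r + k) (m - Poly_Mapping.single k 1)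
    = of_nat ((r + k) * Poly_Mapping.lookup m k) * fact (r + E_of m - 2)
      / (fact (r + V_of m - 1) * type_fact m)"
proof -
  define p where "p = m - Poly_Mapping.single k 1"
  have mp: "m = Poly_Mapping.single k 1 + p"
    using single_plus_minus_single[OF k] by (simp add: p_def)
  have k2: "k \<ge> 2"
    using m k by (auto simp: types_def)
  \<comment> \<open>Writing \<open>r + k\<close> as a successor makes the uniform formula available,
    which also covers \<open>p = 0\<close>.\<close>
  then obtain j where j: "k = Suc j"
    by (cases k) auto
  have "E_of m = k + E_of p" "V_of m = k - 1 + V_of p"
    using V_of_ge[of p] E_of_ge[of p]
    by (auto simp: mp E_of_add V_of_add)
  moreover have "type_fact m = of_nat (Poly_Mapping.lookup m k) * type_fact p" "Poly_Mapping.lookup m k > 0"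
    unfolding mp type_fact_add_single by (simp_all add: lookup_add)
  moreover have "hcat_pow_coeff (r + k) p = of_nat (r + k) * fact (r + k + E_of p - 2)
      / (fact (r + k + V_of p - 2) * type_fact p)"
    using hcat_pow_coeff_Suc[of "r + j" p] j by simp
  ultimately show ?thesis
    unfolding p_def[symmetric] using k2 by (simp add: add.assoc numeral_2_eq_2)
qed

text \<open>Over a common denominator the claim becomes a polynomial identity in \<open>r\<close>
  that is equivalent to Euler's relation.\<close>

lemma hcat_pow_coeff_recurrence:
  assumes "m \<in> types"
  shows "hcat_pow_coeff (Suc r) m = hcat_pow_coeff r m
    + (\<Sum>k\<in>Poly_Mapping.keys m. hcat_pow_coeff (r + k) (m - Poly_Mapping.single k 1))"
proof (cases "m = 0")
  case True
  then show ?thesis by (simp add: hcat_pow_coeff_def)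
next
  case False
  then obtain k where k: "k \<in> Poly_Mapping.keys m"
    using keys_eq_empty by blast
  \<comment> \<open>A nonzero type has \<open>E_of m\<close> at least 3, so neither subtraction
    truncates.\<close>
  define e v where "e = E_of m - 2" and "v = V_of m - 2"
  have "E_of m = 1 + k + (E_of (m - Poly_Mapping.single k 1) - 1)"
    by (subst single_plus_minus_single[OF k, symmetric], subst E_of_add) simp
  moreover have "k \<ge> 2"
    using k assms by (auto simp: types_def)
  ultimately have e: "E_of m = e + 2"
    by (simp add: e_def)
  have v: "V_of m = v + 2"
    using V_of_ge[of m] by (simp add: v_def)
  have f: "v + F_of m = e + 1"
    using euler_VEF[OF assms] e v by simp
  have "(\<Sum>k\<in>Poly_Mapping.keys m. hcat_pow_coeff (r + k) (m - Poly_Mapping.single k 1))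
      = of_nat (\<Sum>k\<in>Poly_Mapping.keys m. (r + k) * Poly_Mapping.lookup m k)
        * fact (r + e) / (fact (Suc (r + v)) * type_fact m)"
    by (simp add: hcat_pow_coeff_minus_single[OF assms, unfolded One_nat_def] e v
        sum_distrib_right sum_divide_distrib)
  \<comment> \<open>The part weighted by \<open>k\<close> is \<open>E_of m - 1\<close>, that is
    \<open>e + 1\<close>.\<close>
  also have "(\<Sum>k\<in>Poly_Mapping.keys m. (r + k) * Poly_Mapping.lookup m k) = r * F_of m + (e + 1)"
    using e by (simp add: F_of_def E_of_def algebra_simps sum.distrib sum_distrib_left)
  finally have S: "(\<Sum>k\<in>Poly_Mapping.keys m. hcat_pow_coeff (r + k) (m - Poly_Mapping.single k 1))
      = of_nat (r * F_of m + (e + 1)) * fact (r + e) / (fact (Suc (r + v)) * type_fact m)" .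
  have "Suc r * Suc (r + e) = r * Suc (r + v) + (r * F_of m + (e + 1))"
  proof -
    have "r * Suc (r + v) + (r * F_of m + (e + 1)) = r * Suc (r + (v + F_of m)) + (e + 1)"
      by (simp add: algebra_simps)
    then show ?thesis
      by (simp add: f algebra_simps)
  qed
  then have key: "of_nat (Suc r) * of_nat (Suc (r + e))
      = of_nat r * of_nat (Suc (r + v)) + (of_nat (r * F_of m + (e + 1)) :: rat)"
    by (metis of_nat_add of_nat_mult)
  have "hcat_pow_coeff (Suc r) m
      = (of_nat (Suc r) * of_nat (Suc (r + e))) * fact (r + e) / (fact (Suc (r + v)) * type_fact m)"
    by (simp add: hcat_pow_coeff_Suc e v del: of_nat_Suc)
  also have "\<dots> = of_nat r * (of_nat (Suc (r + v)) * fact (r + e)) / (of_nat (Suc (r + v)) * fact (r + v) * type_fact m)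
      + of_nat (r * F_of m + (e + 1)) * fact (r + e) / (fact (Suc (r + v)) * type_fact m)"
    unfolding key by (simp add: add_divide_distrib distrib_right mult.assoc del: of_nat_Suc)
  also have "of_nat r * (of_nat (Suc (r + v)) * fact (r + e)) / (of_nat (Suc (r + v)) * fact (r + v) * type_fact m)
      = hcat_pow_coeff r m"
    using False by (simp add: hcat_pow_coeff_def e v del: of_nat_Suc)
  finally show ?thesis
    by (simp only: S)
qed

section \<open>The series with these coefficients\<close>

definition types_on :: "nat set \<Rightarrow> (nat \<Rightarrow>\<^sub>0 nat) set" where
  "types_on K = {m. Poly_Mapping.keys m \<subseteq> K}"

text \<open>The series G_r restricted to entries in \<open>K\<close>, so that \<open>{2..}\<close>
  and \<open>{2..q}\<close> are treated together. That these are powers is proved only in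
  \<open>hcat_pow_eq_power\<close>.\<close>

definition hcat_pow :: "nat set \<Rightarrow> nat \<Rightarrow> series" where
  "hcat_pow K r = mps_infsum (\<lambda>m. mps_monom (type_monom m) (hcat_pow_coeff r m)) (types_on K)"

lemma mps_coeff_hcat_pow:
  assumes "m \<in> types_on K"
  shows "mps_coeff (hcat_pow K r) (type_monom m) = hcat_pow_coeff r m"
  unfolding hcat_pow_def
  by (subst mps_coeff_infsum_superset[where A = "{m}"]) (use assms in auto)

lemma mps_coeff_hcat_pow_eq_0:
  "a \<notin> type_monom ` types_on K \<Longrightarrow> mps_coeff (hcat_pow K r) a = 0"
  unfolding hcat_pow_def
  by (subst mps_coeff_infsum_superset[where A = "{}"]) auto

lemma hcat_pow_0: "hcat_pow K 0 = 1"
proof (rule mps_eqI)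
  fix a
  have z: "0 \<in> types_on K"
    by (simp add: types_on_def)
  show "mps_coeff (hcat_pow K 0) a = mps_coeff 1 a"
  proof (cases "a \<in> type_monom ` types_on K")
    case True
    then obtain m where m: "m \<in> types_on K" "a = type_monom m"
      by auto
    then show ?thesis
      using type_monom_inject[of m 0] by (auto simp: mps_coeff_hcat_pow hcat_pow_coeff_def
          simp del: type_monom_inject)
  next
    case False
    then have "a \<noteq> 0"
      using z type_monom_zero by (metis imageI)
    with False show ?thesis
      by (simp add: mps_coeff_hcat_pow_eq_0)
  qed
qed

text \<open>At the monomial of a type \<open>m\<close> the term for \<open>n\<close> contributes
  only if \<open>n\<close> occurs in \<open>m\<close>, and then through the type with one
  \<open>n\<close> removed; this is the recurrence of the coefficients. Other monomials vanish on
  both sides, since adding an entry from \<open>K\<close> stays in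
  \<open>types_on K\<close>.\<close>

lemma hcat_pow_recurrence:
  assumes K: "K \<subseteq> {2..}"
  shows "hcat_pow K (Suc r)
    = hcat_pow K r + mps_infsum (\<lambda>n. face_var n * hcat_pow K (r + n)) K"
proof (rule mps_eqI)
  fix a
  let ?S = "mps_infsum (\<lambda>n. face_var n * hcat_pow K (r + n)) K"
  have split: "\<exists>m'\<in>types_on K. a = type_monom (Poly_Mapping.single n 1 + m')"
    if "mps_coeff (face_var n * hcat_pow K (r + n)) a \<noteq> 0" for n
    using that unfolding face_var_eq_monom
    by (elim mps_coeff_monom_mult_nonzero)
      (use mps_coeff_hcat_pow_eq_0 in \<open>fastforce simp: type_monom_add\<close>)
  show "mps_coeff (hcat_pow K (Suc r)) a = mps_coeff (hcat_pow K r + ?S) a"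
  proof (cases "a \<in> type_monom ` types_on K")
    case True
    then obtain m where m: "m \<in> types_on K" and a: "a = type_monom m"
      by auto
    have "mps_coeff ?S a
        = (\<Sum>n\<in>Poly_Mapping.keys m. mps_coeff (face_var n * hcat_pow K (r + n)) a)"
    proof (rule mps_coeff_infsum_superset)
      fix n assume "n \<in> K - Poly_Mapping.keys m"
      then have "m \<noteq> Poly_Mapping.single n 1 + m'" for m'
        by (auto simp: in_keys_iff lookup_add)
      then show "mps_coeff (face_var n * hcat_pow K (r + n)) a = 0"
        using split[of n] unfolding a type_monom_inject by blast
    qed (use m in \<open>auto simp: types_on_def\<close>)
    also have "\<dots> = (\<Sum>n\<in>Poly_Mapping.keys m. hcat_pow_coeff (r + n) (m - Poly_Mapping.single n 1))"
    proof (rule sum.cong)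
      fix n assume n: "n \<in> Poly_Mapping.keys m"
      have "a = type_monom (Poly_Mapping.single n 1) + type_monom (m - Poly_Mapping.single n 1)"
        unfolding a type_monom_add[symmetric] using single_plus_minus_single[OF n] by simp
      moreover have "m - Poly_Mapping.single n 1 \<in> types_on K"
        using m keys_minus_single_subset[of m n 1] by (auto simp: types_on_def)
      ultimately show "mps_coeff (face_var n * hcat_pow K (r + n)) a
          = hcat_pow_coeff (r + n) (m - Poly_Mapping.single n 1)"
        unfolding face_var_eq_monom by (simp add: mps_coeff_monom_mult mps_coeff_hcat_pow)
    qed simp
    finally show ?thesis
      using m K by (auto simp: a mps_coeff_hcat_pow hcat_pow_coeff_recurrence types_on_def types_def)
  next
    case False
    have "mps_coeff (face_var n * hcat_pow K (r + n)) a = 0" if n: "n \<in> K" for n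
    proof (rule ccontr)
      assume "mps_coeff (face_var n * hcat_pow K (r + n)) a \<noteq> 0"
      then obtain m' where m': "m' \<in> types_on K" "a = type_monom (Poly_Mapping.single n 1 + m')"
        using split by blast
      then have "Poly_Mapping.single n 1 + m' \<in> types_on K"
        using n Poly_Mapping.keys_add[of "Poly_Mapping.single n 1" m'] by (auto simp: types_on_def)
      with m' False show False
        by blast
    qed
    then have "mps_coeff ?S a = 0"
      by (subst mps_coeff_infsum_superset[where A = "{}"]) auto
    with False show ?thesis
      by (simp add: mps_coeff_hcat_pow_eq_0)
  qed
qed

text \<open>Shifting the index and multiplying by a fixed series both preserve solutions of the
  linear recurrence.\<close>

lemma hcat_pow_eq_power:
  assumes K: "K \<subseteq> {2..}"
  shows "hcat_pow K r = hcat_pow K 1 ^ r"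
proof (induction r)
  case 0
  show ?case by (simp add: hcat_pow_0)
next
  case (Suc r)
  have "hcat_pow K (Suc r) = hcat_pow K 1 * hcat_pow K r"
  proof (rule hcat_recurrence_unique[where P = "\<lambda>r. hcat_pow K (Suc r)"
        and Q = "\<lambda>r. hcat_pow K 1 * hcat_pow K r" and K = K])
    fix r
    show "hcat_pow K (Suc (Suc r)) = hcat_pow K (Suc r)
        + mps_infsum (\<lambda>n. face_var n * hcat_pow K (Suc (r + n))) K"
      using hcat_pow_recurrence[OF K, of "Suc r"] by simp
    show "hcat_pow K 1 * hcat_pow K (Suc r) = hcat_pow K 1 * hcat_pow K r
        + mps_infsum (\<lambda>n. face_var n * (hcat_pow K 1 * hcat_pow K (r + n))) K"
      by (simp add: hcat_pow_recurrence[OF K, of r] distrib_left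
          mps_infsum_mult_left[OF locally_finite_face_var_mult] mult.left_commute)
  qed (simp add: hcat_pow_0)
  with Suc show ?case
    by simp
qed

section \<open>Truncations\<close>

definition h_on :: "nat set \<Rightarrow> series \<Rightarrow> series" where
  "h_on K \<alpha> = 1 - \<alpha> + mps_infsum (\<lambda>n. face_var n * \<alpha> ^ n) K"

lemma h_on_hcat_pow:
  assumes "K \<subseteq> {2..}"
  shows "h_on K (hcat_pow K 1) = 0"
  unfolding h_on_def hcat_pow_eq_power[OF assms, symmetric]
  using hcat_pow_recurrence[OF assms, of 0] by (simp add: hcat_pow_0)

lemma mps_cong_h_on: "mps_cong z k X Y \<Longrightarrow> mps_cong z k (h_on K X) (h_on K Y)"
  unfolding h_on_def
  by (intro mps_cong_add mps_cong_diff mps_cong_infsum mps_cong_mult mps_cong_power) auto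

text \<open>\<open>deg\<close> stands for any of the exponents of \<open>V\<close>, \<open>E\<close>
  and \<open>F\<close>, so one argument serves all truncations.\<close>

lemma mps_mod_h_on_truncation:
  assumes K: "K \<subseteq> {2..}"
    and deg: "\<And>m. Poly_Mapping.lookup (type_monom m) z = deg m"
  shows "mps_mod (h_on K (mps_infsum hcat_term {m \<in> types_on K. deg m \<le> d})) z (d + 1) = 0"
proof -
  have "mps_cong z (d + 1) (mps_infsum hcat_term {m \<in> types_on K. deg m \<le> d}) (hcat_pow K 1)"
    unfolding mps_cong_def hcat_pow_def mps_infsum_def mps_coeff_Abs hcat_pow_coeff_1
      hcat_term_eq_type_monom
    \<comment> \<open>At a monomial of degree at most \<open>d\<close> in \<open>z\<close>, every
      omitted type has coefficient zero, so both sums run over the same types.\<close>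
    using deg by (auto intro!: sum.cong split: if_splits)
  then have "mps_cong z (d + 1) (h_on K (mps_infsum hcat_term {m \<in> types_on K. deg m \<le> d})) 0"
    using mps_cong_h_on h_on_hcat_pow[OF K] by metis
  then show ?thesis
    by (rule mps_mod_eq_0_if_cong)
qed

section \<open>Specialization to the four truncations\<close>

lemma h_eq_h_on: "h = h_on {2..}"
  by (simp add: fun_eq_iff h_def h_on_def face_var_def)

lemma h_upto_eq_h_on: "h_upto q = h_on {2..q}"
  by (simp add: fun_eq_iff h_upto_def h_on_def face_var_def mps_infsum_finite)

lemma types_eq_types_on: "types = types_on {2..}"
  by (simp add: types_def types_on_def)

lemma types_upto_eq_types_on:
  "{m \<in> types. (\<forall>k>q. Poly_Mapping.lookup m k = 0) \<and> F_of m \<le> d} = {m \<in> types_on {2..q}. F_of m \<le> d}"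
proof -
  have "(\<forall>k>q. Poly_Mapping.lookup m k = 0) \<longleftrightarrow> Poly_Mapping.keys m \<subseteq> {..q}" for m
    by (auto simp: subset_iff in_keys_iff not_le[symmetric])
  then show ?thesis
    by (simp add: types_def types_on_def set_eq_iff subset_iff) blast
qed

theorem theorem2:
  fixes d q :: nat
  assumes "q \<ge> 2"
  shows "mps_mod (h (beta_V d)) V (d + 1) = 0
       \<and> mps_mod (h (beta_E d)) E (d + 1) = 0
       \<and> mps_mod (h (beta_F d)) F (d + 1) = 0
       \<and> mps_mod (h_upto q (beta_F_upto d q)) F (d + 1) = 0"
  \<comment> \<open>\<open>types_upto_eq_types_on\<close> has to act while its left side still
    mentions \<open>types\<close>; hence the separate second unfolding.\<close>
  unfolding beta_V_def beta_E_def beta_F_def beta_F_upto_def h_eq_h_on h_upto_eq_h_on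
    types_upto_eq_types_on unfolding types_eq_types_on
  by (intro conjI mps_mod_h_on_truncation) auto

end
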